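(* If $1<|A|<\infty$, then the inequational theory of BCCS($A$) modulo $\precsim_{\rm WIF}$ does not have a finite basis; that is, there is no finite inequational axiomatization over BCCS($A$) that is sound modulo $\precsim_{\rm WIF}$, ground-complete for BCCS($A$) modulo $\precsim_{\rm WIF}$, and $\omega$-complete.
   Context: $A$ is a nonempty set of actions, $\tau\notin A$, $A_\tau=A\cup\{\tau\}$. BCCS($A$) terms: $t::=0\mid x\mid\alpha t\mid t+t$ ($x$ a variable, $\alpha\in A_\tau$). Transitions: $\alpha t\xrightarrow{\alpha}t$; if $t\xrightarrow{\alpha}t'$ then $t+u\xrightarrow{\alpha}t'$ and $u+t\xrightarrow{\alpha}t'$. $\Rightarrow$ is the reflexive-transitive closure of $\xrightarrow{\tau}$. $a_1\cdots a_k\in A^*$ is a weak trace of closed $s$ if $s\Rightarrow\xrightarrow{a_1}\Rightarrow\cdots\xrightarrow{a_k}\Rightarrow s'$; $\mathcal{WT}(s)$ the set. $(a_1\cdots a_k,B)$, $B\subseteq A^*$, is a weak impossible future of $s$ if $s\Rightarrow\xrightarrow{a_1}\Rightarrow\cdots\xrightarrow{a_k}\Rightarrow s'$ with $\mathcal{WT}(s')\cap B=\emptyset$. $s_1\precsim_{\rm WIF}s_2$ iff weak impossible futures of $s_1$ are those of $s_2$, $\mathcal{WT}(s_1)=\mathcal{WT}(s_2)$, and $s_1\xrightarrow{\tau}$ implies $s_2\xrightarrow{\tau}$; on open terms $t\precsim_{\rm WIF}u$ iff $\rho(t)\precsim_{\rm WIF}\rho(u)$ for all closed substitutions $\rho$.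 Inequational logic: reflexivity, transitivity, substitution instances, closure under contexts. Sound: every derivable inequation holds modulo $\precsim_{\rm WIF}$; ground-complete: closed $p\precsim_{\rm WIF}q$ implies $p\preccurlyeq q$ derivable; $\omega$-complete: if all closed instances of $t\preccurlyeq u$ are derivable, then so is $t\preccurlyeq u$. *)

theory Defs
  imports Main
begin

text \<open>The set of actions is the universe of the type variable \<open>'a\<close>; the silent action is the
  extra constructor \<open>Tau\<close>, so it is distinct from every action. Variables come from the countably
  infinite set of natural numbers.\<close>

datatype 'a act = Tau | Vis 'a

datatype 'a bccs =
    Zero
  | Var nat
  | Pref "'a act" "'a bccs"
  | Choice "'a bccs" "'a bccs"

primrec vars :: "'a bccs \<Rightarrow> nat set" where
  "vars Zero = {}"
| "vars (Var x) = {x}"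
| "vars (Pref \<alpha> t) = vars t"
| "vars (Choice t u) = vars t \<union> vars u"

definition closed_term :: "'a bccs \<Rightarrow> bool" where
  "closed_term t \<longleftrightarrow> vars t = {}"

primrec subst :: "(nat \<Rightarrow> 'a bccs) \<Rightarrow> 'a bccs \<Rightarrow> 'a bccs" where
  "subst \<sigma> Zero = Zero"
| "subst \<sigma> (Var x) = \<sigma> x"
| "subst \<sigma> (Pref \<alpha> t) = Pref \<alpha> (subst \<sigma> t)"
| "subst \<sigma> (Choice t u) = Choice (subst \<sigma> t) (subst \<sigma> u)"

definition closed_subst :: "(nat \<Rightarrow> 'a bccs) \<Rightarrow> bool" where
  "closed_subst \<rho> \<longleftrightarrow> (\<forall>x. closed_term (\<rho> x))"

inductive step :: "'a bccs \<Rightarrow> 'a act \<Rightarrow> 'a bccs \<Rightarrow> bool" where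
  step_pref: "step (Pref \<alpha> t) \<alpha> t"
| step_left: "step t \<alpha> t' \<Longrightarrow> step (Choice t u) \<alpha> t'"
| step_right: "step t \<alpha> t' \<Longrightarrow> step (Choice u t) \<alpha> t'"

definition tau_steps :: "'a bccs \<Rightarrow> 'a bccs \<Rightarrow> bool" where
  "tau_steps = (\<lambda>s s'. step s Tau s')\<^sup>*\<^sup>*"

primrec weak_steps :: "'a bccs \<Rightarrow> 'a list \<Rightarrow> 'a bccs \<Rightarrow> bool" where
  "weak_steps s [] s' \<longleftrightarrow> tau_steps s s'"
| "weak_steps s (a # w) s' \<longleftrightarrow>
     (\<exists>s1 s2. tau_steps s s1 \<and> step s1 (Vis a) s2 \<and> weak_steps s2 w s')"

definition weak_traces :: "'a bccs \<Rightarrow> 'a list set" where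
  "weak_traces s = {w. \<exists>s'. weak_steps s w s'}"

definition weak_impossible_futures :: "'a bccs \<Rightarrow> ('a list \<times> 'a list set) set" where
  "weak_impossible_futures s =
     {(w, B). \<exists>s'. weak_steps s w s' \<and> weak_traces s' \<inter> B = {}}"

text \<open>The preorder on closed terms; it is used on open terms only through \<open>wif_le_open\<close>.\<close>

definition wif_le :: "'a bccs \<Rightarrow> 'a bccs \<Rightarrow> bool" where
  "wif_le s1 s2 \<longleftrightarrow>
     weak_impossible_futures s1 \<subseteq> weak_impossible_futures s2 \<and>
     weak_traces s1 = weak_traces s2 \<and>
     ((\<exists>s'. step s1 Tau s') \<longrightarrow> (\<exists>s'. step s2 Tau s'))"

definition wif_le_open :: "'a bccs \<Rightarrow> 'a bccs \<Rightarrow> bool" where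
  "wif_le_open t u \<longleftrightarrow> (\<forall>\<rho>. closed_subst \<rho> \<longrightarrow> wif_le (subst \<rho> t) (subst \<rho> u))"

text \<open>An axiomatization is a set of pairs \<open>(t, u)\<close>, each standing for the inequation
  \<open>t \<preceq> u\<close>.\<close>

inductive derivable :: "('a bccs \<times> 'a bccs) set \<Rightarrow> 'a bccs \<Rightarrow> 'a bccs \<Rightarrow> bool"
  for E :: "('a bccs \<times> 'a bccs) set" where
  deriv_ax: "(t, u) \<in> E \<Longrightarrow> derivable E t u"
| deriv_refl: "derivable E t t"
| deriv_trans: "derivable E t u \<Longrightarrow> derivable E u v \<Longrightarrow> derivable E t v"
| deriv_inst: "derivable E t u \<Longrightarrow> derivable E (subst \<sigma> t) (subst \<sigma> u)"
| deriv_pref: "derivable E t u \<Longrightarrow> derivable E (Pref \<alpha> t) (Pref \<alpha> u)"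
| deriv_choice: "derivable E t1 u1 \<Longrightarrow> derivable E t2 u2 \<Longrightarrow>
                 derivable E (Choice t1 t2) (Choice u1 u2)"

definition sound :: "('a bccs \<times> 'a bccs) set \<Rightarrow> bool" where
  "sound E \<longleftrightarrow> (\<forall>t u. derivable E t u \<longrightarrow> wif_le_open t u)"

definition ground_complete :: "('a bccs \<times> 'a bccs) set \<Rightarrow> bool" where
  "ground_complete E \<longleftrightarrow>
     (\<forall>p q. closed_term p \<longrightarrow> closed_term q \<longrightarrow> wif_le p q \<longrightarrow> derivable E p q)"

definition omega_complete :: "('a bccs \<times> 'a bccs) set \<Rightarrow> bool" where
  "omega_complete E \<longleftrightarrow>
     (\<forall>t u. (\<forall>\<rho>. closed_subst \<rho> \<longrightarrow> derivable E (subst \<rho> t) (subst \<rho> u)) \<longrightarrow>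
            derivable E t u)"

end

theory Submission
  imports Defs
begin

text \<open>For \<open>m > 0\<close> let
  \<open>\<Phi> = \<tau>(a\<^sup>m x + x) + (\<Sum>b\<in>A. \<tau>(a\<^sup>m x + a\<^sup>m b 0))\<close>. The inequation
  \<open>\<tau> a\<^sup>m x + \<Phi> \<preceq> \<Phi>\<close> is sound: for a closed instance \<open>p\<close> of \<open>x\<close>, either \<open>p\<close> has no visible weak
  trace, and then \<open>a\<^sup>m p + p\<close> has the weak traces of \<open>a\<^sup>m p\<close>, or \<open>p\<close> has some weak trace \<open>b\<close>, and
  then \<open>a\<^sup>m p + a\<^sup>m b 0\<close> has the weak traces of \<open>a\<^sup>m p\<close>.

  It is not derivable from sound axioms of size at most \<open>m\<close>, since these preserve the property
  of having a proper \<open>\<tau>\<close>-derivative whose only visible behaviour is \<open>a\<^sup>m x\<close> (a thin derivative),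
  which the left-hand side has and \<open>\<Phi>\<close> lacks. Indeed let \<open>t \<preceq> u\<close> be such an axiom and \<open>t'\<close>
  a \<open>\<tau>\<close>-derivative of \<open>t\<close> with \<open>\<sigma>(t')\<close> thin. Instantiate each variable \<open>y\<close> by \<open>a\<^sup>n b 0\<close> with
  \<open>n > m\<close> depending injectively on \<open>y\<close>. Soundness gives a \<open>\<tau>\<close>-derivative \<open>u'\<close> of \<open>u\<close> whose
  traces after instantiation are among those of \<open>t'\<close>. As \<open>u'\<close> is too small to perform \<open>a\<^sup>n b\<close>
  by itself, it only performs \<open>a\<close>'s and reaches variables only where \<open>t'\<close> does, so \<open>\<sigma>(u')\<close> is
  thin as well.\<close>

section \<open>Traces of open terms\<close>

primrec ptraces :: "'a bccs \<Rightarrow> 'a list set" where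
  "ptraces Zero = {[]}"
| "ptraces (Var x) = {[]}"
| "ptraces (Pref \<alpha> t) = (case \<alpha> of Tau \<Rightarrow> ptraces t | Vis a \<Rightarrow> insert [] (Cons a ` ptraces t))"
| "ptraces (Choice t u) = ptraces t \<union> ptraces u"

text \<open>A pair \<open>(w, x)\<close> records a weak run with trace \<open>w\<close> to a term in
  which \<open>x\<close> occurs unguarded. Together with \<open>ptraces\<close> this determines the
  traces of every instance.\<close>

primrec vtraces :: "'a bccs \<Rightarrow> ('a list \<times> nat) set" where
  "vtraces Zero = {}"
| "vtraces (Var x) = {([], x)}"
| "vtraces (Pref \<alpha> t) = (case \<alpha> of Tau \<Rightarrow> vtraces t | Vis a \<Rightarrow> apfst (Cons a) ` vtraces t)"
| "vtraces (Choice t u) = vtraces t \<union> vtraces u"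

text \<open>At least one step is required: this keeps the set a plain union at
  \<open>Choice\<close>, and the initial-\<open>Tau\<close> clause of \<open>wif_le\<close> speaks
  of its nonemptiness.\<close>

primrec tau_derivs :: "'a bccs \<Rightarrow> 'a bccs set" where
  "tau_derivs Zero = {}"
| "tau_derivs (Var x) = {}"
| "tau_derivs (Pref \<alpha> t) = (case \<alpha> of Tau \<Rightarrow> insert t (tau_derivs t) | Vis a \<Rightarrow> {})"
| "tau_derivs (Choice t u) = tau_derivs t \<union> tau_derivs u"

inductive_cases step_ZeroE: "step Zero \<alpha> s"
inductive_cases step_VarE: "step (Var x) \<alpha> s"
inductive_cases step_PrefE: "step (Pref \<beta> t) \<alpha> s"
inductive_cases step_ChoiceE: "step (Choice t u) \<alpha> s"

lemma step_simps [simp]: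
  "\<not> step Zero \<alpha> s"
  "\<not> step (Var x) \<alpha> s"
  "step (Pref \<beta> t) \<alpha> s \<longleftrightarrow> \<alpha> = \<beta> \<and> s = t"
  "step (Choice t u) \<alpha> s \<longleftrightarrow> step t \<alpha> s \<or> step u \<alpha> s"
  by (auto elim: step_ZeroE step_VarE step_PrefE step_ChoiceE intro: step.intros)

lemma Nil_in_ptraces [simp]: "[] \<in> ptraces t"
  by (induction t) (auto split: act.split)

lemma ptraces_prefix: "v @ w \<in> ptraces t \<Longrightarrow> v \<in> ptraces t"
proof (induction t arbitrary: v)
  case (Pref \<alpha> t)
  then show ?case
    by (cases \<alpha>; cases v) auto
qed auto

lemma fst_vtraces_in_ptraces: "(w, x) \<in> vtraces t \<Longrightarrow> w \<in> ptraces t"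
  by (induction t arbitrary: w) (auto split: act.splits)

lemma length_ptraces_le_size: "w \<in> ptraces t \<Longrightarrow> length w \<le> size t"
  by (induction t arbitrary: w) (auto split: act.splits intro: le_SucI trans_le_add1 trans_le_add2)

lemma ptraces_subst:
  "ptraces (subst \<sigma> t) = ptraces t \<union> (\<Union>(w, x)\<in>vtraces t. (@) w ` ptraces (\<sigma> x))"
proof (induction t)
  case (Pref \<alpha> t)
  show ?case
    by (cases \<alpha>) (simp_all add: Pref image_Un image_UN image_image split_beta)
qed auto

lemma append_in_ptraces_subst:
  "(w, x) \<in> vtraces t \<Longrightarrow> v \<in> ptraces (\<sigma> x) \<Longrightarrow> w @ v \<in> ptraces (subst \<sigma> t)"
  unfolding ptraces_subst by blast

lemma vtraces_subst:
  "vtraces (subst \<sigma> t) = (\<Union>(w, x)\<in>vtraces t. apfst ((@) w) ` vtraces (\<sigma> x))"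
proof (induction t)
  case (Pref \<alpha> t)
  have "(@) (c # w) = (\<lambda>v. c # w @ v)" for c :: 'a and w
    by auto
  then show ?case
    by (cases \<alpha>) (simp_all add: Pref image_UN image_image split_beta apfst_compose o_def)
qed (auto simp: apfst_def map_prod_def split_beta)

lemma tau_derivs_subst:
  "tau_derivs (subst \<sigma> t) =
     subst \<sigma> ` tau_derivs t \<union> (\<Union>x\<in>{x. ([], x) \<in> vtraces t}. tau_derivs (\<sigma> x))"
  by (induction t) (auto split: act.split)

lemma subst_subst: "subst \<sigma> (subst \<theta> t) = subst (\<lambda>x. subst \<sigma> (\<theta> x)) t"
  by (induction t) auto

lemma tau_derivs_traces:
  "t' \<in> tau_derivs t \<Longrightarrow> ptraces t' \<subseteq> ptraces t \<and> vtraces t' \<subseteq> vtraces t"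
  by (induction t) (auto split: act.splits)

lemma step_Tau_in_tau_derivs: "step t Tau t' \<Longrightarrow> t' \<in> tau_derivs t"
  by (induction t) auto

lemma tau_derivs_closed_under_step:
  "t' \<in> tau_derivs t \<Longrightarrow> step t' Tau t'' \<Longrightarrow> t'' \<in> tau_derivs t"
  by (induction t) (auto split: act.splits intro: step_Tau_in_tau_derivs)

lemma tau_derivs_nonempty_iff: "tau_derivs t \<noteq> {} \<longleftrightarrow> (\<exists>t'. step t Tau t')"
  by (induction t) (auto split: act.splits)

text \<open>The first step of a nonempty run resolves the choice. The hypothesis
  \<open>t' \<noteq> t\<close> excludes the empty run, which resolves nothing.\<close>

lemma tau_steps_Choice:
  assumes "tau_steps t t'" "t' \<noteq> t"
  shows "tau_steps (Choice t u) t'" "tau_steps (Choice u t) t'"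
  using assms unfolding tau_steps_def
  by (metis (no_types, lifting) converse_rtranclpE converse_rtranclp_into_rtranclp step_simps(4))+

lemma tau_derivs_size: "t' \<in> tau_derivs t \<Longrightarrow> size t' < size t"
  by (induction t) (auto split: act.splits)

lemma tau_steps_iff: "tau_steps t t' \<longleftrightarrow> t' = t \<or> t' \<in> tau_derivs t"
proof
  assume "tau_steps t t'"
  then show "t' = t \<or> t' \<in> tau_derivs t"
    unfolding tau_steps_def
    by induction (auto intro: step_Tau_in_tau_derivs tau_derivs_closed_under_step)
next
  have "t' \<in> tau_derivs t \<Longrightarrow> tau_steps t t'"
  proof (induction t)
    case (Pref \<alpha> t)
    then have "\<alpha> = Tau" "tau_steps t t'"
      by (auto split: act.splits simp: tau_steps_def)
    then show ?case
      by (auto simp: tau_steps_def intro: converse_rtranclp_into_rtranclp)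
  next
    case (Choice t u)
    then show ?case
      \<comment> \<open>A proper derivative is strictly smaller, hence different from its
        source.\<close>
      using tau_derivs_size[of t' t] tau_derivs_size[of t' u] by (auto intro: tau_steps_Choice)
  qed auto
  then show "t' = t \<or> t' \<in> tau_derivs t \<Longrightarrow> tau_steps t t'"
    by (auto simp: tau_steps_def)
qed

lemma weak_steps_Cons_iff:
  "weak_steps s (a # w) s' \<longleftrightarrow>
     (\<exists>s1 s2. (s1 = s \<or> s1 \<in> tau_derivs s) \<and> step s1 (Vis a) s2 \<and> weak_steps s2 w s')"
  by (simp add: tau_steps_iff)

lemma weak_traces_simps:
  "[] \<in> weak_traces s"
  "a # w \<in> weak_traces s \<longleftrightarrow>
     (\<exists>s2. (step s (Vis a) s2 \<or> (\<exists>s1\<in>tau_derivs s. step s1 (Vis a) s2)) \<and> w \<in> weak_traces s2)"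
  unfolding weak_traces_def mem_Collect_eq weak_steps_Cons_iff
  by (auto simp: tau_steps_iff)

lemma weak_traces_term:
  fixes s u :: "'a bccs"
  shows "weak_traces (Zero :: 'a bccs) = {[]}"
    "weak_traces (Var x :: 'a bccs) = {[]}"
    "weak_traces (Pref Tau s) = weak_traces s"
    "weak_traces (Pref (Vis a) s) = insert [] (Cons a ` weak_traces s)"
    "weak_traces (Choice s u) = weak_traces s \<union> weak_traces u"
proof -
  have eqI: "X = Y" if "\<And>c w. c # w \<in> X \<longleftrightarrow> c # w \<in> Y" "[] \<in> X" "[] \<in> Y"
    for X Y :: "'a list set"
    using that by (metis neq_Nil_conv subsetI subset_antisym)
  show "weak_traces (Zero :: 'a bccs) = {[]}"
    by (rule eqI) (simp_all add: weak_traces_simps)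
  show "weak_traces (Var x :: 'a bccs) = {[]}"
    by (rule eqI) (simp_all add: weak_traces_simps)
  show "weak_traces (Pref Tau s) = weak_traces s"
    by (rule eqI) (auto simp: weak_traces_simps)
  show "weak_traces (Pref (Vis a) s) = insert [] (Cons a ` weak_traces s)"
    by (rule eqI) (auto simp: weak_traces_simps)
  show "weak_traces (Choice s u) = weak_traces s \<union> weak_traces u"
    by (rule eqI) (auto simp: weak_traces_simps)
qed

lemma weak_traces_eq_ptraces: "weak_traces s = ptraces s"
proof (induction s)
  case (Pref \<alpha> s)
  then show ?case by (cases \<alpha>) (simp_all add: weak_traces_term)
qed (simp_all add: weak_traces_term)

lemma wif_le_ptraces: "wif_le s u \<Longrightarrow> ptraces s = ptraces u"
  by (simp add: wif_le_def weak_traces_eq_ptraces)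

section \<open>Consequences of soundness\<close>

definition word :: "'a list \<Rightarrow> 'a bccs" where
  "word w = foldr (\<lambda>a. Pref (Vis a)) w Zero"

lemma word_simps [simp]:
  "closed_term (word w)" "tau_derivs (word w) = {}"
  "v \<in> ptraces (word w) \<longleftrightarrow> (\<exists>v'. w = v @ v')"
proof -
  show "closed_term (word w)" "tau_derivs (word w) = {}"
    by (induction w) (auto simp: word_def closed_term_def)
  show "v \<in> ptraces (word w) \<longleftrightarrow> (\<exists>v'. w = v @ v')"
    by (induction w arbitrary: v) (auto simp: word_def image_iff Cons_eq_append_conv)
qed

lemma replicate_snoc_eq_append:
  assumes "b \<noteq> a" "replicate n a @ [b] = v @ v'"
  shows "(v' = [] \<and> v = replicate n a @ [b]) \<or> (\<exists>i\<le>n. v = replicate i a)"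
proof (cases v' rule: rev_cases)
  case (snoc v'' c)
  with assms have "replicate n a = v @ v''"
    by simp
  then show ?thesis
    by (metis append_eq_conv_conj le_add1 length_append length_replicate take_replicate min_def)
qed (use assms in simp)

text \<open>Plant \<open>c = a^n b\<close> at \<open>z\<close> alone, with
  \<open>n = size u\<close>. The term \<open>u\<close> is too small to perform \<open>w @ c\<close>
  without entering a variable, and that variable can only be \<open>z\<close>. The end marker
  \<open>b\<close> forces all of \<open>c\<close> to be performed there, so \<open>z\<close> is
  reached in \<open>u\<close> after exactly \<open>w\<close>.\<close>

lemma vtraces_mono_if_ptraces_eq:
  fixes a b :: 'a
  assumes "a \<noteq> b"
    and eq: "\<And>\<rho> :: nat \<Rightarrow> 'a bccs. closed_subst \<rho> \<Longrightarrow> ptraces (subst \<rho> t) = ptraces (subst \<rho> u)"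
  shows "vtraces t \<subseteq> vtraces u"
proof clarify
  fix w z assume wz: "(w, z) \<in> vtraces t"
  define c where "c = replicate (size u) a @ [b]"
  define \<rho> :: "nat \<Rightarrow> 'a bccs" where "\<rho> = (\<lambda>_. Zero)(z := word c)"
  have "closed_subst \<rho>"
    by (simp add: \<rho>_def closed_subst_def) (simp add: closed_term_def)
  moreover have "w @ c \<in> ptraces (subst \<rho> t)"
    using wz by (rule append_in_ptraces_subst) (simp add: \<rho>_def)
  ultimately have "w @ c \<in> ptraces (subst \<rho> u)"
    using eq by blast
  moreover have "w @ c \<notin> ptraces u"
    using length_ptraces_le_size[of "w @ c" u] by (auto simp: c_def)
  ultimately obtain w' v y where wv: "w @ c = w' @ v" "(w', y) \<in> vtraces u" "v \<in> ptraces (\<rho> y)"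
    by (auto simp: ptraces_subst)
  have "length w' \<le> size u"
    using wv(2) fst_vtraces_in_ptraces length_ptraces_le_size by blast
  then have "v \<noteq> []"
    using wv(1) by (auto simp: c_def)
  then have "y = z"
    using wv(3) by (auto simp: \<rho>_def split: if_splits)
  then obtain v' where v': "c = v @ v'"
    using wv(3) by (auto simp: \<rho>_def)
  have "last v = b"
    using wv(1) \<open>v \<noteq> []\<close> by (metis c_def append_assoc last_appendR last_snoc)
  then have "v = c"
    using replicate_snoc_eq_append[of b a "size u" v v'] v' \<open>v \<noteq> []\<close> \<open>a \<noteq> b\<close>
    by (auto simp: c_def)
  then show "(w, z) \<in> vtraces u"
    using wv \<open>y = z\<close> by simp
qed

lemma wif_le_open_traces:
  fixes a b :: 'a and t u :: "'a bccs"
  assumes "a \<noteq> b" "wif_le_open t u"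
  shows "ptraces t = ptraces u" "vtraces t = vtraces u"
proof -
  have eq: "ptraces (subst \<rho> t) = ptraces (subst \<rho> u)" if "closed_subst \<rho>" for \<rho>
    using assms(2) that unfolding wif_le_open_def by (blast intro!: wif_le_ptraces)
  then show "vtraces t = vtraces u"
    using vtraces_mono_if_ptraces_eq[OF assms(1), of t u]
      vtraces_mono_if_ptraces_eq[OF assms(1), of u t] by auto
  have "ptraces (subst (\<lambda>_. Zero) s) = ptraces s" for s :: "'a bccs"
    by (auto simp: ptraces_subst intro: fst_vtraces_in_ptraces)
  then show "ptraces t = ptraces u"
    using eq[of "\<lambda>_. Zero"] by (simp add: closed_subst_def closed_term_def)
qed

text \<open>Use the impossible future made of the empty trace and the complement of
  \<open>ptraces s'\<close>. If its witness in \<open>u\<close> is \<open>u\<close> itself, the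
  clause on initial \<open>Tau\<close> steps supplies a proper derivative, which has no more
  traces.\<close>

lemma wif_le_tau_derivs:
  assumes "wif_le s u" "s' \<in> tau_derivs s"
  shows "\<exists>u'\<in>tau_derivs u. ptraces u' \<subseteq> ptraces s'"
proof -
  have "([], - ptraces s') \<in> weak_impossible_futures s"
    using assms(2) by (auto simp: weak_impossible_futures_def weak_traces_eq_ptraces tau_steps_iff)
  then have "([], - ptraces s') \<in> weak_impossible_futures u"
    using assms(1) by (auto simp: wif_le_def)
  then obtain u' where u': "u' = u \<or> u' \<in> tau_derivs u" "ptraces u' \<subseteq> ptraces s'"
    by (auto simp: weak_impossible_futures_def weak_traces_eq_ptraces tau_steps_iff)
  obtain u'' where "u'' \<in> tau_derivs u"
    using assms tau_derivs_nonempty_iff[of s] tau_derivs_nonempty_iff[of u]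
    by (auto simp: wif_le_def)
  then show ?thesis
    using u' tau_derivs_traces by blast
qed

section \<open>Thin derivatives\<close>

text \<open>Inclusions instead of equalities make thinness pass to any term with fewer
  traces.\<close>

definition thin :: "'a \<Rightarrow> nat \<Rightarrow> nat \<Rightarrow> 'a bccs \<Rightarrow> bool" where
  "thin a m x t \<longleftrightarrow> ptraces t \<subseteq> {replicate j a |j. j \<le> m} \<and> vtraces t \<subseteq> {(replicate m a, x)}"

definition has_thin_deriv :: "'a \<Rightarrow> nat \<Rightarrow> nat \<Rightarrow> 'a bccs \<Rightarrow> bool" where
  "has_thin_deriv a m x t \<longleftrightarrow> (\<exists>t'\<in>tau_derivs t. thin a m x t')"

text \<open>Uniqueness of quotient and remainder; it serves to decode a length
  \<open>k + N y\<close>.\<close>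

lemma add_mult_eq_cancel:
  fixes j k y z n :: nat
  assumes "j + n * z = k + n * y" "j < n" "k < n"
  shows "j = k \<and> z = y"
proof -
  have "(j + n * z) div n = z" "(k + n * y) div n = y"
    using assms(2,3) by simp_all
  then have "z = y"
    using assms(1) by simp
  then show ?thesis
    using assms(1) by simp
qed

lemma wif_le_open_thin_deriv:
  fixes a b :: 'a and t u :: "'a bccs"
  assumes "a \<noteq> b" and le: "wif_le_open t u" and size: "size u \<le> m"
    and t': "t' \<in> tau_derivs t" and thin: "thin a m x (subst \<sigma> t')"
  shows "\<exists>u'\<in>tau_derivs u. thin a m x (subst \<sigma> u')"
proof -
  \<comment> \<open>These lengths exceed \<open>m\<close>, out of reach of \<open>u\<close> alone.
    As multiples of \<open>Suc m\<close> they let \<open>k + N y\<close> determine both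
    \<open>k \<le> m\<close> and \<open>y\<close>.\<close>
  define N where "N y = Suc m * Suc y" for y
  define \<rho> :: "nat \<Rightarrow> 'a bccs" where "\<rho> y = word (replicate (N y) a @ [b])" for y
  have "closed_subst \<rho>"
    by (simp add: \<rho>_def closed_subst_def)
  then have "wif_le (subst \<rho> t) (subst \<rho> u)"
    using le by (auto simp: wif_le_open_def)
  moreover have "subst \<rho> t' \<in> tau_derivs (subst \<rho> t)"
    using t' by (auto simp: tau_derivs_subst)
  ultimately obtain s where s: "s \<in> tau_derivs (subst \<rho> u)" "ptraces s \<subseteq> ptraces (subst \<rho> t')"
    using wif_le_tau_derivs by blast
  \<comment> \<open>The words \<open>\<rho> y\<close> have no \<open>Tau\<close> steps, so
    \<open>s\<close> is an instance of a derivative of \<open>u\<close>.\<close>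
  then obtain u' where u': "u' \<in> tau_derivs u" "ptraces (subst \<rho> u') \<subseteq> ptraces (subst \<rho> t')"
    by (auto simp: tau_derivs_subst \<rho>_def)
  have short: "length w \<le> m" if "w \<in> ptraces u'" for w
    using that tau_derivs_traces[OF u'(1)] length_ptraces_le_size[of w u] size by auto
  have pt': "\<exists>j\<le>m. w = replicate j a" if "w \<in> ptraces t'" for w
    using that thin by (auto simp: thin_def ptraces_subst)
  have cases: "(\<exists>i. w = replicate i a) \<or>
      (\<exists>k y. k \<le> m \<and> (replicate k a, y) \<in> vtraces t' \<and> w = replicate (k + N y) a @ [b])"
    if w: "w \<in> ptraces (subst \<rho> t')" for w
  proof (cases "w \<in> ptraces t'")
    case True
    then show ?thesis using pt' by blast
  next
    case False
    then obtain w' v v' y where v: "w = w' @ v" "(w', y) \<in> vtraces t'"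
        "replicate (N y) a @ [b] = v @ v'"
      using w by (auto simp: ptraces_subst \<rho>_def)
    obtain k where k: "k \<le> m" "w' = replicate k a"
      using pt' fst_vtraces_in_ptraces[OF v(2)] by blast
    show ?thesis
      using replicate_snoc_eq_append[OF _ v(3)] \<open>a \<noteq> b\<close> v k
      by (auto simp: replicate_add simp flip: append_assoc)
        (auto simp flip: replicate_add)
  qed
  have pu': "\<exists>j\<le>m. w = replicate j a" if "w \<in> ptraces u'" for w
  proof -
    have "w \<in> ptraces (subst \<rho> t')"
      using that u'(2) by (auto simp: ptraces_subst)
    then show ?thesis
      \<comment> \<open>The alternative ending in \<open>b\<close> is longer than
        \<open>m\<close>.\<close>
      using cases[of w] short[OF that] by (auto simp: N_def)
  qed
  have vu': "(w, z) \<in> vtraces t'" if wz: "(w, z) \<in> vtraces u'" for w z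
  proof -
    obtain j where j: "j \<le> m" "w = replicate j a"
      using pu' fst_vtraces_in_ptraces[OF wz] by blast
    have "replicate (N z) a @ [b] \<in> ptraces (\<rho> z)"
      by (simp add: \<rho>_def)
    then have "w @ replicate (N z) a @ [b] \<in> ptraces (subst \<rho> t')"
      using u'(2) append_in_ptraces_subst[OF wz] by blast
    moreover have "w @ replicate (N z) a @ [b] \<noteq> replicate i a" for i
      using \<open>a \<noteq> b\<close> by (metis append_assoc in_set_conv_decomp in_set_replicate)
    ultimately obtain k y where k: "k \<le> m" "(replicate k a, y) \<in> vtraces t'"
        "w @ replicate (N z) a @ [b] = replicate (k + N y) a @ [b]"
      using cases by blast
    then have "j + N z = k + N y"
      using j by (auto dest: arg_cong[where f = length])
    then have "j = k \<and> Suc z = Suc y"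
      unfolding N_def by (rule add_mult_eq_cancel) (use j(1) k(1) in simp_all)
    then show ?thesis
      using j k by simp
  qed
  have "thin a m x (subst \<sigma> u')"
    unfolding thin_def
  proof
    show "vtraces (subst \<sigma> u') \<subseteq> {(replicate m a, x)}"
      using thin vu' unfolding thin_def vtraces_subst by blast
    \<comment> \<open>A trace of the instance stays inside \<open>u'\<close> or leaves it through a
      variable that \<open>t'\<close> reaches by the same word.\<close>
    have "ptraces (subst \<sigma> u') \<subseteq> ptraces u' \<union> ptraces (subst \<sigma> t')"
      using vu' unfolding ptraces_subst by blast
    then show "ptraces (subst \<sigma> u') \<subseteq> {replicate j a |j. j \<le> m}"
      using thin pu' by (auto simp: thin_def)
  qed
  then show ?thesis
    using u'(1) by blast
qed

text \<open>Quantifying over \<open>\<sigma>\<close> lets the instance rule follow by composing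
  substitutions.\<close>

lemma derivable_thin_deriv:
  fixes a b :: 'a
  assumes "a \<noteq> b" and sound: "sound E" and size: "\<And>t u. (t, u) \<in> E \<Longrightarrow> size u \<le> m"
  shows "derivable E p q \<Longrightarrow>
    has_thin_deriv a m x (subst \<sigma> p) \<Longrightarrow> has_thin_deriv a m x (subst \<sigma> q)"
proof (induction arbitrary: \<sigma> rule: derivable.induct)
  case (deriv_ax t u)
  have le: "wif_le_open t u"
    using sound derivable.deriv_ax[OF deriv_ax(1)] by (auto simp: sound_def)
  obtain s where s: "s \<in> tau_derivs (subst \<sigma> t)" "thin a m x s"
    using deriv_ax(2) unfolding has_thin_deriv_def by blast
  \<comment> \<open>The derivative stems from the axiom itself or from a term substituted for an
    unguarded variable; the latter is unguarded in \<open>u\<close> too.\<close>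
  from s(1) consider t' where "t' \<in> tau_derivs t" "s = subst \<sigma> t'"
    | y where "([], y) \<in> vtraces t" "s \<in> tau_derivs (\<sigma> y)"
    unfolding tau_derivs_subst by blast
  then show ?case
  proof cases
    case 1
    then obtain u' where "u' \<in> tau_derivs u" "thin a m x (subst \<sigma> u')"
      using wif_le_open_thin_deriv[OF \<open>a \<noteq> b\<close> le size[OF deriv_ax(1)]] s(2) by blast
    then show ?thesis
      unfolding has_thin_deriv_def tau_derivs_subst by blast
  next
    case 2
    then show ?thesis
      using wif_le_open_traces(2)[OF \<open>a \<noteq> b\<close> le] s(2)
      unfolding has_thin_deriv_def tau_derivs_subst by blast
  qed
next
  case (deriv_inst t u \<theta>)
  then show ?case by (simp add: subst_subst)
next
  case (deriv_pref t u \<alpha>)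
  \<comment> \<open>A \<open>Tau\<close> prefix makes the whole argument a new derivative, about
    which the induction hypothesis says nothing; its thinness transfers because soundness preserves
    both kinds of traces.\<close>
  have "wif_le_open (subst \<sigma> t) (subst \<sigma> u)"
    using sound derivable.deriv_inst[OF deriv_pref(1)] by (auto simp: sound_def)
  then have "thin a m x (subst \<sigma> t) \<longleftrightarrow> thin a m x (subst \<sigma> u)"
    by (simp add: thin_def wif_le_open_traces[OF \<open>a \<noteq> b\<close>])
  then show ?case
    using deriv_pref.IH[of \<sigma>] deriv_pref.prems
    by (auto simp: has_thin_deriv_def split: act.splits)
next
  case (deriv_choice t1 u1 t2 u2)
  from deriv_choice.prems deriv_choice.IH[of \<sigma>] show ?case
    unfolding has_thin_deriv_def subst.simps tau_derivs.simps by blast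
qed auto

section \<open>The infinite family of inequations\<close>

definition apow :: "'a \<Rightarrow> nat \<Rightarrow> 'a bccs \<Rightarrow> 'a bccs" where
  "apow a m t = (Pref (Vis a) ^^ m) t"

lemma apow_simps [simp]:
  "subst \<sigma> (apow a m t) = apow a m (subst \<sigma> t)"
  "ptraces (apow a 0 t) = ptraces t"
  "ptraces (apow a (Suc m) t) = insert [] (Cons a ` ptraces (apow a m t))"
  "vtraces (apow a m t) = apfst ((@) (replicate m a)) ` vtraces t"
  "tau_derivs (apow a (Suc m) t) = {}"
proof -
  show "vtraces (apow a m t) = apfst ((@) (replicate m a)) ` vtraces t"
    by (induction m) (simp_all add: apow_def image_image apfst_def map_prod_def split_beta)
qed (induction m, auto simp: apow_def)

lemma ptraces_apow_Var: "w \<in> ptraces (apow a m (Var x)) \<Longrightarrow> \<exists>j\<le>m. w = replicate j a"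
proof (induction m arbitrary: w)
  case (Suc m)
  show ?case
  proof (cases w)
    case Nil
    then show ?thesis by (intro exI[of _ 0]) simp
  next
    case (Cons c v)
    with Suc obtain j where "j \<le> m" "w = replicate (Suc j) a" by auto
    then show ?thesis by (intro exI[of _ "Suc j"]) simp
  qed
qed simp

lemma append_in_ptraces_apow: "v \<in> ptraces t \<Longrightarrow> replicate m a @ v \<in> ptraces (apow a m t)"
  by (induction m) auto

lemma ptraces_apow_mono: "ptraces t \<subseteq> ptraces u \<Longrightarrow> ptraces (apow a m t) \<subseteq> ptraces (apow a m u)"
  by (induction m) auto

text \<open>The list \<open>bs\<close> enumerates the actions of the sum, and a term
  \<open>t\<close> replaces the variable so that instances have the same form.\<close>

definition Phi :: "'a \<Rightarrow> nat \<Rightarrow> 'a list \<Rightarrow> 'a bccs \<Rightarrow> 'a bccs" where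
  "Phi a m bs t = foldr (\<lambda>b. Choice (Pref Tau (Choice (apow a m t) (apow a m (Pref (Vis b) Zero)))))
     bs (Pref Tau (Choice (apow a m t) t))"

lemma subst_Phi: "subst \<sigma> (Phi a m bs t) = Phi a m bs (subst \<sigma> t)"
  by (induction bs) (simp_all add: Phi_def)

lemma step_Phi:
  "step (Phi a m bs t) \<alpha> s \<longleftrightarrow> \<alpha> = Tau \<and> (s = Choice (apow a m t) t \<or>
     (\<exists>b\<in>set bs. s = Choice (apow a m t) (apow a m (Pref (Vis b) Zero))))"
  by (induction bs) (auto simp: Phi_def)

text \<open>The positive exponent guards the powers of \<open>a\<close>, so further derivatives come
  from \<open>t\<close> only.\<close>

lemma tau_derivs_Phi:
  "tau_derivs (Phi a (Suc m) bs t) =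
     insert (Choice (apow a (Suc m) t) t)
       ((\<lambda>b. Choice (apow a (Suc m) t) (apow a (Suc m) (Pref (Vis b) Zero))) ` set bs) \<union>
     tau_derivs t"
  by (induction bs) (auto simp: Phi_def)

lemma Phi_inequation_wif_le:
  fixes p :: "'a bccs"
  assumes bs: "set bs = UNIV"
  shows "wif_le (Choice (Pref Tau (apow a (Suc m) p)) (Phi a (Suc m) bs p)) (Phi a (Suc m) bs p)"
    (is "wif_le (Choice (Pref Tau ?q) ?F) ?F")
proof -
  have inF: "Choice ?q p \<in> tau_derivs ?F"
    by (simp add: tau_derivs_Phi)
  then have qF: "ptraces ?q \<subseteq> ptraces ?F"
    using tau_derivs_traces by fastforce
  have same: "\<exists>r. r \<in> tau_derivs ?F \<and> ptraces r \<subseteq> ptraces ?q"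
  proof (cases "ptraces p = {[]}")
    case True
    then show ?thesis using inF by (intro exI[of _ "Choice ?q p"]) auto
  next
    case False
    then obtain b v where "b # v \<in> ptraces p"
      by (metis Nil_in_ptraces insertI1 neq_Nil_conv singletonD subsetI subset_antisym)
    then have "[b] \<in> ptraces p"
      using ptraces_prefix[of "[b]" v] by simp
    then have "ptraces (apow a (Suc m) (Pref (Vis b) Zero)) \<subseteq> ptraces ?q"
      by (intro ptraces_apow_mono) auto
    then show ?thesis
      using bs by (intro exI[of _ "Choice ?q (apow a (Suc m) (Pref (Vis b) Zero))"])
        (auto simp: tau_derivs_Phi simp del: apow_simps)
  qed
  have "(w, B) \<in> weak_impossible_futures ?F"
    if "(w, B) \<in> weak_impossible_futures (Choice (Pref Tau ?q) ?F)" for w B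
  proof -
    from that obtain s where s: "weak_steps (Choice (Pref Tau ?q) ?F) w s" "ptraces s \<inter> B = {}"
      by (auto simp: weak_impossible_futures_def weak_traces_eq_ptraces)
    have "\<exists>s'. weak_steps ?F w s' \<and> ptraces s' \<subseteq> ptraces s"
    proof (cases w)
      case Nil
      then consider "s = Choice (Pref Tau ?q) ?F" | "s = ?q" | "s \<in> tau_derivs ?F"
        using s(1) by (auto simp: tau_steps_iff)
      then show ?thesis
      proof cases
        case 1
        then show ?thesis using Nil by (intro exI[of _ ?F]) (auto simp: tau_steps_iff)
      next
        case 2
        then show ?thesis using Nil same by (auto simp: tau_steps_iff)
      next
        case 3
        then show ?thesis using Nil by (auto simp: tau_steps_iff)
      qed
    next
      case (Cons c v)
      then obtain s1 s2 where s1: "s1 = Choice (Pref Tau ?q) ?F \<or> s1 = ?q \<or> s1 \<in> tau_derivs ?F"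
          "step s1 (Vis c) s2" "weak_steps s2 v s"
        using s(1) by (auto simp: weak_steps_Cons_iff simp del: weak_steps.simps)
      \<comment> \<open>The initial state has no visible step, and one from \<open>?q\<close> is
        also a step of \<open>Choice ?q p\<close>.\<close>
      have "\<exists>s1. s1 \<in> tau_derivs ?F \<and> step s1 (Vis c) s2"
      proof (cases "s1 \<in> tau_derivs ?F")
        case False
        then have "step (Choice ?q p) (Vis c) s2"
          using s1 by (auto simp: step_Phi)
        then show ?thesis using inF by blast
      qed (use s1 in blast)
      then have "weak_steps ?F w s"
        using s1(3) unfolding Cons weak_steps_Cons_iff by blast
      then show ?thesis by blast
    qed
    then show ?thesis
      using s(2) by (auto simp: weak_impossible_futures_def weak_traces_eq_ptraces)
  qed
  then show ?thesis
    using qF unfolding wif_le_def weak_traces_eq_ptraces by (auto simp: step_Phi)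
qed

text \<open>One derivative shows \<open>x\<close> after the empty trace; the others perform a word
  of length \<open>m + 2\<close>.\<close>

lemma Phi_no_thin_deriv: "\<not> has_thin_deriv a (Suc m) x (Phi a (Suc m) bs (Var x))"
proof -
  have "\<not> thin a (Suc m) x (Choice (apow a (Suc m) (Var x)) (Var x))"
    by (auto simp: thin_def)
  moreover have "\<not> thin a (Suc m) x
      (Choice (apow a (Suc m) (Var x)) (apow a (Suc m) (Pref (Vis b) Zero)))" (is "\<not> thin _ _ _ ?r") for b
  proof
    assume "thin a (Suc m) x ?r"
    moreover have "replicate (Suc m) a @ [b] \<in> ptraces ?r"
      using append_in_ptraces_apow[of "[b]" "Pref (Vis b) Zero" "Suc m" a] by simp
    ultimately obtain j where "j \<le> Suc m" "replicate (Suc m) a @ [b] = replicate j a"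
      unfolding thin_def by blast
    \<comment> \<open>Lengths are compared because \<open>b\<close> may equal
      \<open>a\<close>.\<close>
    then show False
      by (auto dest: arg_cong[where f = length])
  qed
  ultimately show ?thesis
    by (auto simp: has_thin_deriv_def tau_derivs_Phi)
qed

theorem theorem6p9:
  assumes "finite (UNIV :: 'a set)"
    and "1 < card (UNIV :: 'a set)"
  shows "\<not> (\<exists>E :: ('a bccs \<times> 'a bccs) set.
            finite E \<and> sound E \<and> ground_complete E \<and> omega_complete E)"
proof
  assume "\<exists>E :: ('a bccs \<times> 'a bccs) set.
            finite E \<and> sound E \<and> ground_complete E \<and> omega_complete E"
  then obtain E :: "('a bccs \<times> 'a bccs) set"
    where E: "finite E" "sound E" "ground_complete E" "omega_complete E" by blast
  obtain a b :: 'a where "a \<noteq> b"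
    using assms(2) by (metis (full_types) card_le_Suc0_iff_eq assms(1) One_nat_def not_le)
  obtain bs :: "'a list" where bs: "set bs = UNIV"
    using finite_list[OF assms(1)] by blast
  \<comment> \<open>The sum over the finite set \<open>E\<close> bounds the size of each right-hand
    side.\<close>
  define m where "m = (\<Sum>(t, u)\<in>E. size u)"
  have size: "size u \<le> Suc m" if "(t, u) \<in> E" for t u
    using member_le_sum[OF that, of "\<lambda>(t, u). size u"] E(1) by (simp add: m_def)
  define F where "F t = Phi a (Suc m) bs t" for t
  define L where "L t = Choice (Pref Tau (apow a (Suc m) t)) (F t)" for t
  have closed: "closed_term (apow a k t)" if "closed_term t" for k and t :: "'a bccs"
    using that by (induction k) (auto simp: apow_def closed_term_def)
  have closedF: "closed_term (F t)" if "closed_term t" for t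
    unfolding F_def using closed[OF that, of "Suc m"] closed[of "Pref (Vis _) Zero" "Suc m"] that
    by (induction bs) (auto simp: Phi_def closed_term_def)
  have "derivable E (subst \<rho> (L (Var 0))) (subst \<rho> (F (Var 0)))" if "closed_subst \<rho>" for \<rho>
  proof -
    have "closed_term (\<rho> 0)"
      using that by (simp add: closed_subst_def)
    then have "closed_term (L (\<rho> 0))" "closed_term (F (\<rho> 0))"
      using closed closedF by (auto simp: L_def closed_term_def)
    moreover have "wif_le (L (\<rho> 0)) (F (\<rho> 0))"
      unfolding L_def F_def by (rule Phi_inequation_wif_le[OF bs])
    ultimately have "derivable E (L (\<rho> 0)) (F (\<rho> 0))"
      using E(3) by (auto simp: ground_complete_def)
    then show ?thesis
      by (simp add: L_def F_def subst_Phi)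
  qed
  then have "derivable E (L (Var 0)) (F (Var 0))"
    using E(4) by (auto simp: omega_complete_def)
  moreover have "has_thin_deriv a (Suc m) 0 (subst Var (L (Var 0)))"
  proof -
    have "thin a (Suc m) 0 (apow a (Suc m) (Var 0))"
      using ptraces_apow_Var[of _ a "Suc m" 0] unfolding thin_def by auto
    then show ?thesis
      by (auto simp: has_thin_deriv_def L_def simp del: apow_simps(2,3,5))
  qed
  \<comment> \<open>The invariant is applied at the identity substitution
    \<open>Var\<close>.\<close>
  ultimately have "has_thin_deriv a (Suc m) 0 (subst Var (F (Var 0)))"
    using derivable_thin_deriv[OF \<open>a \<noteq> b\<close> E(2), of "Suc m"] size by blast
  then show False
    by (simp add: F_def subst_Phi Phi_no_thin_deriv)
qed

end
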